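(* Let $G$ be one of the following Hanaki groups (under matrix multiplication): $$A(n,v) = \left\{ \begin{bmatrix} 1 & 0 & 0\\ a & 1 & 0\\ b & v(a) & 1\end{bmatrix} : a,b\in GF(2^n)\right\},$$ where $n\ge 2$ and $v$ is the Frobenius automorphism $x\mapsto x^2$ of $GF(2^n)$; or $$A(n,p) = \left\{ \begin{bmatrix} 1 & 0 & 0\\ a & 1 & 0\\ b & c & 1\end{bmatrix} : a,b,c\in GF(p^n)\right\},$$ where $p$ is a prime and $n\ge 1$. Then $E(\Gamma_{nc}(G)) = LE(\Gamma_{nc}(G))$.
   Context: For a finite non-abelian group $G$ with center $Z(G)$, the non-commuting graph $\Gamma_{nc}(G)$ is the simple undirected graph with vertex set $G\setminus Z(G)$, in which two vertices $x,y$ are adjacent if and only if $xy \ne yx$. For a finite simple graph $\mathcal{G}$ with vertex set $v(\mathcal{G})$ and edge set $e(\mathcal{G})$, the energy $E(\mathcal{G})$ is the sum of $|\lambda|$ over the eigenvalues $\lambda$ of the adjacency matrix $\mathcal{A}(\mathcal{G})$, and the Laplacian energy is $LE(\mathcal{G}) = \sum_{\mu}\left|\mu - \frac{2|e(\mathcal{G})|}{|v(\mathcal{G})|}\right|$, the sum over the eigenvalues $\mu$ of the Laplacian matrix $L(\mathcal{G}) = D(\mathcal{G}) - \mathcal{A}(\mathcal{G})$, where $D(\mathcal{G})$ is the diagonal degree matrix; eigenvalues are counted with multiplicity. *)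

theory Defs
  imports
    "HOL-Library.Cardinality"
    "HOL-Library.Multiset"
    "Jordan_Normal_Form.Char_Poly"
begin

section \<open>Finite simple graphs and their energies\<close>

record 'v sgraph =
  verts :: "'v set"
  edges :: "'v set set"

definition degree_of :: "'v sgraph \<Rightarrow> 'v \<Rightarrow> nat" where
  "degree_of \<G> x = card {e \<in> edges \<G>. x \<in> e}"

text \<open>Matrices are indexed by \<open>{0..<n}\<close>, so the matrices of a graph refer to an enumeration
  of its vertices.  The entries are complex, so that no eigenvalue can be lost when the
  roots of the characteristic polynomial are collected.\<close>

definition is_enum :: "'v sgraph \<Rightarrow> 'v list \<Rightarrow> bool" where
  "is_enum \<G> xs \<longleftrightarrow> distinct xs \<and> set xs = verts \<G>"

definition adjacency_mat :: "'v sgraph \<Rightarrow> 'v list \<Rightarrow> complex mat" where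
  "adjacency_mat \<G> xs =
     mat (length xs) (length xs) (\<lambda>(i, j). if {xs ! i, xs ! j} \<in> edges \<G> then 1 else 0)"

definition degree_mat :: "'v sgraph \<Rightarrow> 'v list \<Rightarrow> complex mat" where
  "degree_mat \<G> xs = mat_diag (length xs) (\<lambda>i. of_nat (degree_of \<G> (xs ! i)))"

definition laplacian_mat :: "'v sgraph \<Rightarrow> 'v list \<Rightarrow> complex mat" where
  "laplacian_mat \<G> xs = degree_mat \<G> xs - adjacency_mat \<G> xs"

definition eigenvalues_mset :: "complex mat \<Rightarrow> complex multiset" where
  "eigenvalues_mset A = proots (char_poly A)"

text \<open>The choice of the enumeration is immaterial: see \<open>energy_eq\<close> and
  \<open>laplacian_energy_eq\<close> below.\<close>

definition energy :: "'v sgraph \<Rightarrow> real" where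
  "energy \<G> =
     (\<Sum>\<mu>\<in>#eigenvalues_mset (adjacency_mat \<G> (SOME xs. is_enum \<G> xs)). cmod \<mu>)"

definition laplacian_energy :: "'v sgraph \<Rightarrow> real" where
  "laplacian_energy \<G> =
     (\<Sum>\<mu>\<in>#eigenvalues_mset (laplacian_mat \<G> (SOME xs. is_enum \<G> xs)).
        cmod (\<mu> - 2 * of_nat (card (edges \<G>)) / of_nat (card (verts \<G>))))"

lemma similar_mat_reindex:
  fixes f :: "'v \<Rightarrow> 'v \<Rightarrow> complex"
  assumes xs: "distinct xs" and ys: "distinct ys" and eq: "set xs = set ys"
  shows "similar_mat (mat (length xs) (length xs) (\<lambda>(i, j). f (xs ! i) (xs ! j)))
                     (mat (length ys) (length ys) (\<lambda>(i, j). f (ys ! i) (ys ! j)))"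
proof -
  define n where "n = length xs"
  have ny: "length ys = n"
    using assms distinct_card[of xs] distinct_card[of ys] by (simp add: n_def)
  define P :: "complex mat" where "P = mat n n (\<lambda>(i, j). if xs ! i = ys ! j then 1 else 0)"
  define Q :: "complex mat" where "Q = mat n n (\<lambda>(i, j). if ys ! i = xs ! j then 1 else 0)"
  define A where "A = mat n n (\<lambda>(i, j). f (xs ! i) (xs ! j))"
  define B where "B = mat n n (\<lambda>(i, j). f (ys ! i) (ys ! j))"
  have sum_list_ix: "(\<Sum>k = 0..<n. g (zs ! k)) = (\<Sum>z\<in>set xs. g z)"
    if "zs = xs \<or> zs = ys" for g :: "'v \<Rightarrow> complex" and zs
  proof -
    have zs: "length zs = n" "distinct zs" "set zs = set xs"
      using that assms ny by (auto simp: n_def)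
    have "(\<Sum>z\<in>set zs. g z) = sum_list (map g zs)"
      using zs(2) by (simp add: sum_list_distinct_conv_sum_set)
    also have "\<dots> = (\<Sum>k = 0..<n. g (zs ! k))"
      using zs(1) by (simp add: sum_list_sum_nth)
    finally show ?thesis using zs(3) by simp
  qed
  have mem: "xs ! i \<in> set xs" "ys ! i \<in> set xs" if "i < n" for i
    using nth_mem[of i xs] nth_mem[of i ys] that eq ny n_def by simp_all
  have inj: "xs ! i = xs ! j \<longleftrightarrow> i = j" "ys ! i = ys ! j \<longleftrightarrow> i = j" if "i < n" "j < n" for i j
    using nth_eq_iff_index_eq[OF xs, of i j] nth_eq_iff_index_eq[OF ys, of i j] that ny n_def
    by simp_all
  have PQ: "P * Q = 1\<^sub>m n"
  proof (rule eq_matI)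
    fix i j assume ij: "i < dim_row (1\<^sub>m n)" "j < dim_col (1\<^sub>m n)"
    have "(P * Q) $$ (i, j) = (\<Sum>k = 0..<n. (if xs ! i = ys ! k then 1 else 0) *
        (if ys ! k = xs ! j then 1 else 0))"
      using ij by (simp add: P_def Q_def scalar_prod_def)
    also have "\<dots> = (\<Sum>z\<in>set xs. (if xs ! i = z then 1 else 0) * (if z = xs ! j then 1 else 0))"
      by (rule sum_list_ix[of ys "\<lambda>z. (if xs ! i = z then 1 else 0) * (if z = xs ! j then 1 else 0)"]) simp
    also have "\<dots> = (\<Sum>z\<in>set xs. if xs ! i = z then (if z = xs ! j then 1 else 0) else 0)"
      by (rule sum.cong) auto
    also have "\<dots> = (if xs ! i = xs ! j then 1 else 0)"
      using mem ij by simp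
    finally show "(P * Q) $$ (i, j) = 1\<^sub>m n $$ (i, j)"
      using ij inj by simp
  qed (simp_all add: P_def Q_def)
  have QP: "Q * P = 1\<^sub>m n"
    by (rule mat_mult_left_right_inverse[OF _ _ PQ]) (simp_all add: P_def Q_def)
  have AP: "A * P = P * B"
  proof (rule eq_matI)
    fix i j assume "i < dim_row (P * B)" "j < dim_col (P * B)"
    then have ij: "i < n" "j < n" by (simp_all add: P_def B_def)
    have "(A * P) $$ (i, j) = (\<Sum>k = 0..<n. f (xs ! i) (xs ! k) *
        (if xs ! k = ys ! j then 1 else 0))"
      using ij by (simp add: P_def A_def scalar_prod_def)
    also have "\<dots> = (\<Sum>z\<in>set xs. f (xs ! i) z * (if z = ys ! j then 1 else 0))"
      by (rule sum_list_ix[of xs "\<lambda>z. f (xs ! i) z * (if z = ys ! j then 1 else 0)"]) simp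
    also have "\<dots> = (\<Sum>z\<in>set xs. if z = ys ! j then f (xs ! i) z else 0)"
      by (rule sum.cong) auto
    also have "\<dots> = f (xs ! i) (ys ! j)"
      using mem ij by simp
    finally have L: "(A * P) $$ (i, j) = f (xs ! i) (ys ! j)" .
    have "(P * B) $$ (i, j) = (\<Sum>k = 0..<n. (if xs ! i = ys ! k then 1 else 0) *
        f (ys ! k) (ys ! j))"
      using ij by (simp add: P_def B_def scalar_prod_def)
    also have "\<dots> = (\<Sum>z\<in>set xs. (if xs ! i = z then 1 else 0) * f z (ys ! j))"
      by (rule sum_list_ix[of ys "\<lambda>z. (if xs ! i = z then 1 else 0) * f z (ys ! j)"]) simp
    also have "\<dots> = (\<Sum>z\<in>set xs. if xs ! i = z then f z (ys ! j) else 0)"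
      by (rule sum.cong) auto
    also have "\<dots> = f (xs ! i) (ys ! j)"
      using mem ij by simp
    finally show "(A * P) $$ (i, j) = (P * B) $$ (i, j)" using L by simp
  qed (simp_all add: A_def P_def B_def)
  have carr: "A \<in> carrier_mat n n" "B \<in> carrier_mat n n" "P \<in> carrier_mat n n" "Q \<in> carrier_mat n n"
    by (simp_all add: A_def B_def P_def Q_def)
  have "A = A * (P * Q)" using carr by (simp add: PQ)
  also have "\<dots> = A * P * Q" using carr by (simp add: assoc_mult_mat[of A n n P n Q n])
  also have "\<dots> = P * B * Q" by (simp add: AP)
  finally have "A = P * B * Q" .
  then have "similar_mat_wit A B P Q"
    using carr PQ QP by (auto simp: similar_mat_wit_def Let_def)
  then show ?thesis
    unfolding similar_mat_def using ny by (auto simp: A_def B_def n_def)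
qed

lemma laplacian_mat_altdef:
  assumes "distinct xs"
  shows "laplacian_mat \<G> xs = mat (length xs) (length xs) (\<lambda>(i, j).
    (\<lambda>x y. (if x = y then of_nat (degree_of \<G> x) else 0) - (if {x, y} \<in> edges \<G> then 1 else 0))
      (xs ! i) (xs ! j))"
  by (rule eq_matI)
    (use assms in \<open>auto simp: laplacian_mat_def degree_mat_def adjacency_mat_def mat_diag_def
      nth_eq_iff_index_eq\<close>)

lemma ex_is_enum: "finite (verts \<G>) \<Longrightarrow> \<exists>xs. is_enum \<G> xs"
  unfolding is_enum_def using finite_distinct_list by blast

lemma is_enum_SOME: "is_enum \<G> xs \<Longrightarrow> is_enum \<G> (SOME xs. is_enum \<G> xs)"
  by (rule someI)

lemma energy_eq:
  assumes "is_enum \<G> xs"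
  shows "energy \<G> = (\<Sum>\<mu>\<in>#eigenvalues_mset (adjacency_mat \<G> xs). cmod \<mu>)"
proof -
  have d: "distinct xs" "distinct (SOME xs. is_enum \<G> xs)" "set (SOME xs. is_enum \<G> xs) = set xs"
    using assms is_enum_SOME[OF assms] unfolding is_enum_def by simp_all
  have "char_poly (adjacency_mat \<G> (SOME xs. is_enum \<G> xs)) = char_poly (adjacency_mat \<G> xs)"
    unfolding adjacency_mat_def
    by (intro char_poly_similar similar_mat_reindex[where f = "\<lambda>x y. if {x, y} \<in> edges \<G> then 1 else 0"] d)
  then show ?thesis by (simp add: energy_def eigenvalues_mset_def)
qed

lemma laplacian_energy_eq:
  assumes "is_enum \<G> xs"
  shows "laplacian_energy \<G> = (\<Sum>\<mu>\<in>#eigenvalues_mset (laplacian_mat \<G> xs).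
    cmod (\<mu> - 2 * of_nat (card (edges \<G>)) / of_nat (card (verts \<G>))))"
proof -
  have d: "distinct xs" "distinct (SOME xs. is_enum \<G> xs)" "set (SOME xs. is_enum \<G> xs) = set xs"
    using assms is_enum_SOME[OF assms] unfolding is_enum_def by simp_all
  have "char_poly (laplacian_mat \<G> (SOME xs. is_enum \<G> xs)) = char_poly (laplacian_mat \<G> xs)"
    unfolding laplacian_mat_altdef[OF d(1)] laplacian_mat_altdef[OF d(2)]
    by (intro char_poly_similar similar_mat_reindex d)
  then show ?thesis by (simp add: laplacian_energy_def eigenvalues_mset_def)
qed


section \<open>The non-commuting graph of a group\<close>

definition group_center :: "('a, 'b) monoid_scheme \<Rightarrow> 'a set" where
  "group_center G =
     {z \<in> carrier G. \<forall>g\<in>carrier G. z \<otimes>\<^bsub>G\<^esub> g = g \<otimes>\<^bsub>G\<^esub> z}"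

definition non_commuting_graph :: "('a, 'b) monoid_scheme \<Rightarrow> 'a sgraph" where
  "non_commuting_graph G = \<lparr>
     verts = carrier G - group_center G,
     edges = {{x, y} | x y. x \<in> carrier G - group_center G \<and> y \<in> carrier G - group_center G \<and>
                x \<otimes>\<^bsub>G\<^esub> y \<noteq> y \<otimes>\<^bsub>G\<^esub> x} \<rparr>"


section \<open>The Hanaki groups\<close>

text \<open>The field \<open>GF(q)\<close> is rendered as an arbitrary type of sorts \<open>field\<close> and \<open>finite\<close> with
  \<open>q\<close> elements, so that \<open>n\<close> and \<open>p\<close> enter only through the cardinality of that type.\<close>

definition hanaki_mat :: "'a :: field \<Rightarrow> 'a \<Rightarrow> 'a \<Rightarrow> 'a mat" where
  "hanaki_mat a b c = mat_of_rows_list 3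
     [[1, 0, 0],
      [a, 1, 0],
      [b, c, 1]]"

definition hanaki_Av :: "('a :: field \<Rightarrow> 'a) \<Rightarrow> 'a mat monoid" where
  "hanaki_Av v = \<lparr> carrier = {hanaki_mat a b (v a) | a b. True}, mult = (*), one = 1\<^sub>m 3 \<rparr>"

definition hanaki_Ap :: "'a :: field mat monoid" where
  "hanaki_Ap = \<lparr> carrier = {hanaki_mat a b c | a b c. True}, mult = (*), one = 1\<^sub>m 3 \<rparr>"

lemma hanaki_mat_mult:
  "hanaki_mat a b c * hanaki_mat a' b' c' = hanaki_mat (a + a') (b + c * a' + b') (c + c')"
  by (rule eq_matI)
    (auto simp: hanaki_mat_def mat_of_rows_list_def scalar_prod_def numeral_3_eq_3 less_Suc_eq
      algebra_simps)

lemma one_hanaki_mat: "1\<^sub>m 3 = hanaki_mat 0 0 0"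
  by (rule eq_matI)
    (auto simp: hanaki_mat_def mat_of_rows_list_def numeral_3_eq_3 less_Suc_eq)

lemma group_hanaki_Ap: "group hanaki_Ap"
proof (rule groupI)
  fix x :: "'a mat" assume "x \<in> carrier hanaki_Ap"
  then obtain a b c where x: "x = hanaki_mat a b c" by (auto simp: hanaki_Ap_def)
  have "hanaki_mat (- a) (c * a - b) (- c) * x = 1\<^sub>m 3"
    by (simp add: x hanaki_mat_mult one_hanaki_mat)
  then show "\<exists>y\<in>carrier hanaki_Ap. y \<otimes>\<^bsub>hanaki_Ap\<^esub> x = \<one>\<^bsub>hanaki_Ap\<^esub>"
    by (auto simp: hanaki_Ap_def)
next
  fix x y :: "'a mat" assume "x \<in> carrier hanaki_Ap" "y \<in> carrier hanaki_Ap"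
  then show "x \<otimes>\<^bsub>hanaki_Ap\<^esub> y \<in> carrier hanaki_Ap"
    by (auto simp: hanaki_Ap_def hanaki_mat_mult) blast
qed (auto simp: hanaki_Ap_def hanaki_mat_mult one_hanaki_mat algebra_simps)

lemma group_hanaki_Av:
  fixes v :: "'a :: field \<Rightarrow> 'a"
  assumes add: "\<And>x y. v (x + y) = v x + v y"
  shows "group (hanaki_Av v)"
proof (rule groupI)
  have v0: "v 0 = 0" using add[of 0 0] by (metis add.right_neutral add_left_cancel)
  have vm: "v (- x) = - v x" for x using add[of x "- x"] v0
    by (metis add.commute eq_neg_iff_add_eq_0 right_minus)
  show "\<one>\<^bsub>hanaki_Av v\<^esub> \<in> carrier (hanaki_Av v)"
    by (auto simp: hanaki_Av_def one_hanaki_mat) (metis v0)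
  fix x :: "'a mat" assume "x \<in> carrier (hanaki_Av v)"
  then obtain a b where x: "x = hanaki_mat a b (v a)" by (auto simp: hanaki_Av_def)
  have "hanaki_mat (- a) (v a * a - b) (v (- a)) * x = 1\<^sub>m 3"
    by (simp add: x hanaki_mat_mult one_hanaki_mat vm)
  then show "\<exists>y\<in>carrier (hanaki_Av v). y \<otimes>\<^bsub>hanaki_Av v\<^esub> x = \<one>\<^bsub>hanaki_Av v\<^esub>"
    by (auto simp: hanaki_Av_def)
next
  fix x y :: "'a mat" assume "x \<in> carrier (hanaki_Av v)" "y \<in> carrier (hanaki_Av v)"
  then show "x \<otimes>\<^bsub>hanaki_Av v\<^esub> y \<in> carrier (hanaki_Av v)"
    by (auto simp: hanaki_Av_def hanaki_mat_mult simp flip: add) blast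
qed (auto simp: hanaki_Av_def hanaki_mat_mult one_hanaki_mat algebra_simps)

end

theory Submission
  imports Defs
begin

text \<open>The energy and the Laplacian energy agree on every regular graph.  If all vertices have
  degree \<open>d\<close>, then the Laplacian matrix is \<open>d I - A\<close>, so its eigenvalues are the numbers \<open>d - \<lambda>\<close> for
  \<open>\<lambda>\<close> an eigenvalue of \<open>A\<close>; by the handshake identity \<open>2 |e| / |v| = d\<close>, and therefore each
  summand of the Laplacian energy is \<open>\<bar>(d - \<lambda>) - d\<bar> = \<bar>\<lambda>\<bar>\<close>
  (\<open>energy_eq_laplacian_energy_if_regular\<close>).

  A vertex \<open>x\<close> of the non-commuting graph of \<open>G\<close> is joined exactly to the elements outside its
  centralizer, so the graph is regular as soon as all non-central elements have centralizers of the
  same size.  In both families of Hanaki groups this can be read off the product formula: with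
  \<open>q\<close> the order of the field, the commutation of two matrices is the vanishing of the
  determinant of their \<open>(a, c)\<close>-entries, and the centralizers of non-central elements have
  \<open>2 q\<close> elements in \<open>A(n,v)\<close> and \<open>q\<^sup>2\<close> elements in \<open>A(n,p)\<close>.\<close>

section \<open>Energies of regular graphs\<close>

text \<open>The characteristic polynomial of \<open>c I - A\<close> at \<open>x\<close> is the determinant of
  \<open>-((c - x) I - A)\<close>, that is, up to sign, the characteristic polynomial of \<open>A\<close> at \<open>c - x\<close>.  Splitting
  the latter into linear factors absorbs the sign and keeps track of multiplicities.\<close>

lemma eigenvalues_mset_scalar_minus:
  assumes A: "A \<in> carrier_mat n n"
  shows "eigenvalues_mset (c \<cdot>\<^sub>m 1\<^sub>m n - A) = image_mset (\<lambda>\<mu>. c - \<mu>) (eigenvalues_mset A)"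
proof -
  obtain as where as: "char_poly A = (\<Prod>a\<leftarrow>as. [:- a, 1:])" and len: "length as = n"
    using char_poly_factorized[OF A] by blast
  let ?B = "c \<cdot>\<^sub>m 1\<^sub>m n - A"
  have B: "?B \<in> carrier_mat n n" by (rule minus_carrier_mat[OF A])
  have "poly (char_poly ?B) x = poly (\<Prod>a\<leftarrow>map (\<lambda>a. c - a) as. [:- a, 1:]) x" for x
  proof -
    have neg: "- char_matrix ?B x = (-1) \<cdot>\<^sub>m (- char_matrix A (c - x))"
      by (rule eq_matI) (use A in \<open>auto simp: char_matrix_def\<close>)
    have "poly (char_poly ?B) x = (-1) ^ n * poly (char_poly A) (c - x)"
      unfolding char_poly_matrix[OF B] char_poly_matrix[OF A] neg det_smult
      using A by (simp add: char_matrix_def)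
    also have "\<dots> = (-1) ^ length as * (\<Prod>a\<leftarrow>as. c - x - a)"
      by (simp add: as len poly_prod_list o_def)
    also have "\<dots> = (\<Prod>a\<leftarrow>as. x - (c - a))"
      by (induction as) (simp_all add: algebra_simps)
    also have "\<dots> = poly (\<Prod>a\<leftarrow>map (\<lambda>a. c - a) as. [:- a, 1:]) x"
      by (simp add: poly_prod_list o_def algebra_simps)
    finally show ?thesis .
  qed
  then have "char_poly ?B = (\<Prod>a\<leftarrow>map (\<lambda>a. c - a) as. [:- a, 1:])"
    by (simp flip: poly_eq_poly_eq_iff add: fun_eq_iff)
  moreover have "proots (\<Prod>a\<leftarrow>bs. [:- a, 1:]) = mset bs" for bs :: "complex list"
  proof (induction bs)
    case (Cons b bs)
    have "(\<Prod>a\<leftarrow>bs. [:- a, 1:]) \<noteq> 0" by (auto simp: prod_list_zero_iff)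
    then show ?case using Cons by (simp add: proots_mult del: mult_pCons_left)
  qed simp
  ultimately show ?thesis by (simp add: eigenvalues_mset_def as del: map_map)
qed

lemma sum_degree_of:
  assumes "finite (verts \<G>)" "\<And>e. e \<in> edges \<G> \<Longrightarrow> e \<subseteq> verts \<G> \<and> card e = 2"
  shows "(\<Sum>x\<in>verts \<G>. degree_of \<G> x) = 2 * card (edges \<G>)"
  unfolding degree_of_def
proof (rule sum_multicount)
  show "finite (edges \<G>)"
    using assms by (intro finite_subset[of "edges \<G>" "Pow (verts \<G>)"]) auto
  show "\<forall>e\<in>edges \<G>. card {x \<in> verts \<G>. x \<in> e} = 2"
  proof
    fix e assume "e \<in> edges \<G>"
    moreover from this have "{x \<in> verts \<G>. x \<in> e} = e" using assms(2) by blast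
    ultimately show "card {x \<in> verts \<G>. x \<in> e} = 2" using assms(2) by simp
  qed
qed (fact assms(1))

lemma energy_eq_laplacian_energy_if_regular:
  assumes fin: "finite (verts \<G>)"
    and graph: "\<And>e. e \<in> edges \<G> \<Longrightarrow> e \<subseteq> verts \<G> \<and> card e = 2"
    and regular: "\<And>x. x \<in> verts \<G> \<Longrightarrow> degree_of \<G> x = d"
  shows "energy \<G> = laplacian_energy \<G>"
proof -
  obtain xs where xs: "is_enum \<G> xs" using ex_is_enum[OF fin] by blast
  let ?A = "adjacency_mat \<G> xs"
  have A: "?A \<in> carrier_mat (length xs) (length xs)" by (simp add: adjacency_mat_def)
  have "degree_mat \<G> xs = of_nat d \<cdot>\<^sub>m 1\<^sub>m (length xs)"
    using xs nth_mem[of _ xs] regular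
    by (intro eq_matI) (auto simp: degree_mat_def mat_diag_def is_enum_def)
  then have L: "eigenvalues_mset (laplacian_mat \<G> xs)
      = image_mset (\<lambda>\<mu>. of_nat d - \<mu>) (eigenvalues_mset ?A)"
    by (simp add: laplacian_mat_def eigenvalues_mset_scalar_minus[OF A])
  show ?thesis
  proof (cases "verts \<G> = {}")
    case True
    \<comment> \<open>The average degree is \<open>0 / 0 = 0\<close> here, but there are no eigenvalues to sum over.\<close>
    then have "xs = []" using xs by (simp add: is_enum_def)
    then have "char_poly ?A = 1"
      using degree_monic_char_poly[OF A] by (auto elim!: degree_eq_zeroE simp: one_pCons)
    then have "eigenvalues_mset ?A = {#}" by (simp add: eigenvalues_mset_def)
    then show ?thesis by (simp add: energy_eq[OF xs] laplacian_energy_eq[OF xs] L)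
  next
    case False
    have "d * card (verts \<G>) = 2 * card (edges \<G>)"
      using sum_degree_of[OF fin graph] regular by (simp add: mult.commute)
    then have "2 * of_nat (card (edges \<G>)) = (of_nat d * of_nat (card (verts \<G>)) :: complex)"
      by (metis of_nat_mult of_nat_numeral)
    then have avg: "2 * of_nat (card (edges \<G>)) / of_nat (card (verts \<G>)) = (of_nat d :: complex)"
      using False fin by simp
    show ?thesis
      unfolding energy_eq[OF xs] laplacian_energy_eq[OF xs] L avg by (simp add: multiset.map_comp o_def)
  qed
qed

section \<open>Groups whose non-central elements have centralizers of the same size\<close>

text \<open>An element that fails to commute with \<open>x\<close> is itself non-central, so the neighbours of \<open>x\<close> are all
  elements outside its centralizer and its degree is the order of \<open>G\<close> minus \<open>k\<close>.\<close>

lemma energy_non_commuting_graph_eq_laplacian_energy: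
  fixes G :: "('a, 'b) monoid_scheme"
  assumes fin: "finite (carrier G)"
    and centralizer: "\<And>x. x \<in> carrier G - group_center G \<Longrightarrow>
      card {y \<in> carrier G. x \<otimes>\<^bsub>G\<^esub> y = y \<otimes>\<^bsub>G\<^esub> x} = k"
  shows "energy (non_commuting_graph G) = laplacian_energy (non_commuting_graph G)"
proof (rule energy_eq_laplacian_energy_if_regular)
  show "finite (verts (non_commuting_graph G))"
    using fin by (simp add: non_commuting_graph_def)
  show "e \<subseteq> verts (non_commuting_graph G) \<and> card e = 2"
    if "e \<in> edges (non_commuting_graph G)" for e
    using that by (auto simp: non_commuting_graph_def card_2_iff)
  fix x assume "x \<in> verts (non_commuting_graph G)"
  then have x: "x \<in> carrier G - group_center G" by (simp add: non_commuting_graph_def)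
  let ?C = "{y \<in> carrier G. x \<otimes>\<^bsub>G\<^esub> y = y \<otimes>\<^bsub>G\<^esub> x}"
  have "{e \<in> edges (non_commuting_graph G). x \<in> e} = (\<lambda>y. {x, y}) ` (carrier G - ?C)"
  proof (intro equalityI subsetI)
    fix e assume "e \<in> {e \<in> edges (non_commuting_graph G). x \<in> e}"
    then show "e \<in> (\<lambda>y. {x, y}) ` (carrier G - ?C)"
      by (auto simp: non_commuting_graph_def insert_commute)
  next
    fix e assume "e \<in> (\<lambda>y. {x, y}) ` (carrier G - ?C)"
    then obtain y where y: "y \<in> carrier G" "x \<otimes>\<^bsub>G\<^esub> y \<noteq> y \<otimes>\<^bsub>G\<^esub> x" "e = {x, y}" by auto
    moreover from y x have "y \<notin> group_center G" by (force simp: group_center_def)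
    ultimately show "e \<in> {e \<in> edges (non_commuting_graph G). x \<in> e}"
      using x by (auto simp: non_commuting_graph_def)
  qed
  moreover have "inj_on (\<lambda>y. {x, y}) (carrier G - ?C)"
    by (auto simp: inj_on_def doubleton_eq_iff)
  ultimately have "degree_of (non_commuting_graph G) x = card (carrier G - ?C)"
    by (simp add: degree_of_def card_image)
  also have "\<dots> = card (carrier G) - k"
    using fin centralizer[OF x] by (subst card_Diff_subset) auto
  finally show "degree_of (non_commuting_graph G) x = card (carrier G) - k" .
qed

section \<open>Centralizers in the Hanaki groups\<close>

lemma hanaki_mat_eq_iff:
  "hanaki_mat a b c = hanaki_mat a' b' c' \<longleftrightarrow> a = a' \<and> b = b' \<and> c = c'"
proof
  assume eq: "hanaki_mat a b c = hanaki_mat a' b' c'"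
  have "hanaki_mat a b c $$ (1, 0) = a" "hanaki_mat a b c $$ (2, 0) = b"
    "hanaki_mat a b c $$ (2, 1) = c" for a b c :: 'a
    by (simp_all add: hanaki_mat_def mat_of_rows_list_def)
  then show "a = a' \<and> b = b' \<and> c = c'" using eq by metis
qed simp

lemma hanaki_mat_commute_iff:
  "hanaki_mat a b c * hanaki_mat a' b' c' = hanaki_mat a' b' c' * hanaki_mat a b c \<longleftrightarrow>
     c * a' = c' * a"
  by (auto simp: hanaki_mat_mult hanaki_mat_eq_iff algebra_simps)

text \<open>For \<open>a \<noteq> 0\<close> the condition \<open>a\<^sup>2 a' = a'\<^sup>2 a\<close> leaves only \<open>a' = 0\<close> and \<open>a' = a\<close>, with the
  lower left entry arbitrary.\<close>

lemma card_centralizer_hanaki_Av: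
  fixes x :: "'a :: {field, finite} mat"
  assumes "x \<in> carrier (hanaki_Av (\<lambda>a. a ^ 2)) - group_center (hanaki_Av (\<lambda>a. a ^ 2))"
  shows "card {y \<in> carrier (hanaki_Av (\<lambda>a. a ^ 2)).
           x \<otimes>\<^bsub>hanaki_Av (\<lambda>a. a ^ 2)\<^esub> y = y \<otimes>\<^bsub>hanaki_Av (\<lambda>a. a ^ 2)\<^esub> x} = 2 * CARD('a)"
    (is "card ?C = _")
proof -
  obtain a b where x: "x = hanaki_mat a b (a ^ 2)" using assms by (auto simp: hanaki_Av_def)
  have a: "a \<noteq> 0"
  proof
    assume "a = 0"
    then have "x \<in> group_center (hanaki_Av (\<lambda>a. a ^ 2))"
      using assms by (auto simp: x group_center_def hanaki_Av_def hanaki_mat_commute_iff hanaki_mat_eq_iff)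
    with assms show False by simp
  qed
  have sol: "a ^ 2 * a' = a' ^ 2 * a \<longleftrightarrow> a' \<in> {0, a}" for a'
    using a by (auto simp: power2_eq_square)
  have "?C = (\<lambda>(a', b'). hanaki_mat a' b' (a' ^ 2)) ` ({0, a} \<times> UNIV)"
    using sol by (auto simp: x hanaki_Av_def hanaki_mat_commute_iff)
  moreover have "inj_on (\<lambda>(a', b'). hanaki_mat a' b' (a' ^ 2)) ({0, a} \<times> UNIV)"
    by (auto simp: inj_on_def hanaki_mat_eq_iff)
  ultimately have "card ?C = card ({0, a} \<times> (UNIV :: 'a set))" by (simp only: card_image)
  also have "\<dots> = 2 * CARD('a)" using a by (simp add: card_cartesian_product)
  finally show ?thesis .
qed

text \<open>The equation \<open>c a' = c' a\<close> says that \<open>(a', c')\<close> lies on the line spanned by \<open>(a, c) \<noteq> (0, 0)\<close>,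
  so the centralizer is parametrized by a scalar \<open>t\<close> and the lower left entry.\<close>

lemma card_centralizer_hanaki_Ap:
  fixes x :: "'a :: {field, finite} mat"
  assumes "x \<in> carrier hanaki_Ap - group_center hanaki_Ap"
  shows "card {y \<in> carrier hanaki_Ap. x \<otimes>\<^bsub>hanaki_Ap\<^esub> y = y \<otimes>\<^bsub>hanaki_Ap\<^esub> x} = CARD('a) ^ 2"
    (is "card ?C = _")
proof -
  obtain a b c where x: "x = hanaki_mat a b c" using assms by (auto simp: hanaki_Ap_def)
  have ac: "a \<noteq> 0 \<or> c \<noteq> 0"
  proof (rule ccontr)
    assume "\<not> (a \<noteq> 0 \<or> c \<noteq> 0)"
    then have "x \<in> group_center hanaki_Ap"
      using assms by (auto simp: x group_center_def hanaki_Ap_def hanaki_mat_commute_iff hanaki_mat_eq_iff)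
    with assms show False by simp
  qed
  have sol: "c * a' = c' * a \<longleftrightarrow> (\<exists>t. a' = t * a \<and> c' = t * c)" for a' c'
  proof
    assume eq: "c * a' = c' * a"
    show "\<exists>t. a' = t * a \<and> c' = t * c"
    proof (cases "a = 0")
      case True
      then show ?thesis using eq ac by (intro exI[of _ "c' / c"]) auto
    next
      case False
      then show ?thesis using eq by (intro exI[of _ "a' / a"]) (simp add: field_simps)
    qed
  qed auto
  have "?C = (\<lambda>(t, b'). hanaki_mat (t * a) b' (t * c)) ` (UNIV \<times> UNIV)"
    using sol by (auto simp: x hanaki_Ap_def hanaki_mat_commute_iff image_iff) blast
  moreover have "inj_on (\<lambda>(t, b'). hanaki_mat (t * a) b' (t * c)) (UNIV \<times> UNIV)"
    using ac by (auto simp: inj_on_def hanaki_mat_eq_iff)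
  ultimately have "card ?C = card ((UNIV :: 'a set) \<times> (UNIV :: 'a set))" by (simp only: card_image)
  then show ?thesis by (simp only: card_cartesian_product power2_eq_square)
qed

lemma finite_carrier_hanaki_Av: "finite (carrier (hanaki_Av v :: 'a :: {field, finite} mat monoid))"
proof -
  have "carrier (hanaki_Av v) = range (\<lambda>(a, b). hanaki_mat a b (v a))"
    by (auto simp: hanaki_Av_def)
  then show ?thesis by simp
qed

lemma finite_carrier_hanaki_Ap: "finite (carrier (hanaki_Ap :: 'a :: {field, finite} mat monoid))"
proof -
  have "carrier hanaki_Ap = range (\<lambda>(a :: 'a, b, c). hanaki_mat a b c)"
    by (auto simp: hanaki_Ap_def image_iff hanaki_mat_eq_iff)
  then show ?thesis by simp
qed

theorem theorem4p16:
  fixes G :: "'a :: {field, finite} mat monoid"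
    and n p :: nat
  assumes "(n \<ge> 2 \<and> CARD('a) = 2 ^ n \<and> G = hanaki_Av (\<lambda>x. x ^ 2)) \<or>
           (prime p \<and> n \<ge> 1 \<and> CARD('a) = p ^ n \<and> G = hanaki_Ap)"
  shows "energy (non_commuting_graph G) = laplacian_energy (non_commuting_graph G)"
  using assms
proof (elim disjE conjE)
  assume "G = hanaki_Av (\<lambda>x. x ^ 2)"
  then show ?thesis
    using energy_non_commuting_graph_eq_laplacian_energy[OF finite_carrier_hanaki_Av]
      card_centralizer_hanaki_Av by blast
next
  assume "G = hanaki_Ap"
  then show ?thesis
    using energy_non_commuting_graph_eq_laplacian_energy[OF finite_carrier_hanaki_Ap]
      card_centralizer_hanaki_Ap by blast
qed

end
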